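(* Let $A\ge 2$ and $C>0$. Then $$\int_0^\infty\left[(u'(s))^2+C\left(\frac{u(s)}{s}\right)^2\right]e^{-s^2/2}s^{A-1}\,ds\ \ge\ \frac{-(A-2)+\sqrt{(A-2)^2+4C}}{2}\int_0^\infty u^2(s)\,e^{-s^2/2}s^{A-1}\,ds.$$ The equality holds if and only if $u(s)=c\,s^{\frac{-(A-2)+\sqrt{(A-2)^2+4C}}{2}}$, where $c$ is a constant.
   Context: Here $u$ denotes a real-valued function on $(0,\infty)$ and $u'$ its derivative; the source states the inequality without specifying a function class for $u$. *)

theory Defs
  imports "HOL-Analysis.Analysis"
begin

definition gauss_weight :: "real \<Rightarrow> real \<Rightarrow> real" where
  "gauss_weight A s = exp (- (s\<^sup>2 / 2)) * s powr (A - 1)"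

text \<open>The optimal constant, which is also the exponent of the extremal functions: the
  positive root of \<open>x\<^sup>2 + (A - 2) * x = C\<close>.\<close>

definition sharp_const :: "real \<Rightarrow> real \<Rightarrow> real" where
  "sharp_const A C = (- (A - 2) + sqrt ((A - 2)\<^sup>2 + 4 * C)) / 2"

text \<open>Both integrands are nonnegative, so the integrals are taken in \<^typ>\<open>ennreal\<close>. They are
  then meaningful for every differentiable \<open>u\<close>, a divergent integral having the value \<open>\<infinity>\<close>
  (whereas a divergent Bochner integral would be \<open>0\<close>).\<close>

definition weighted_energy :: "real \<Rightarrow> real \<Rightarrow> (real \<Rightarrow> real) \<Rightarrow> ennreal" where
  "weighted_energy A C u =
     (\<integral>\<^sup>+ s \<in> {0<..}. ennreal (((deriv u s)\<^sup>2 + C * (u s / s)\<^sup>2) * gauss_weight A s) \<partial>lborel)"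

definition weighted_mass :: "real \<Rightarrow> (real \<Rightarrow> real) \<Rightarrow> ennreal" where
  "weighted_mass A u = (\<integral>\<^sup>+ s \<in> {0<..}. ennreal ((u s)\<^sup>2 * gauss_weight A s) \<partial>lborel)"

end

theory Submission
  imports Defs "HOL-Real_Asymp.Real_Asymp"
begin

text \<open>Let \<open>k\<close> be the sharp constant, \<open>w\<close> the weight and \<open>G = u\<^sup>2 w / s\<close>. Since
  \<open>k\<^sup>2 + (A - 2) k = C\<close>, completing the square gives the pointwise identity
  \<open>(u'\<^sup>2 + C (u / s)\<^sup>2) w = k u\<^sup>2 w + (u' - k u / s)\<^sup>2 w + k G'\<close>.
  Integrated over \<open>[a, b]\<close>, the boundary term at \<open>b\<close> has the favourable sign. If the energy is
  finite, the one at \<open>a\<close> vanishes along a sequence tending to \<open>0\<close>. So the energy dominates \<open>k\<close>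
  times the mass plus the integral of the square, and equality forces \<open>u' = k u / s\<close> almost
  everywhere.\<close>

section \<open>The sharp constant and the Gaussian weight\<close>

lemma sharp_const_pos:
  assumes "C > 0"
  shows "sharp_const A C > 0"
proof -
  have "\<bar>A - 2\<bar> = sqrt ((A - 2)\<^sup>2)" by simp
  also have "\<dots> < sqrt ((A - 2)\<^sup>2 + 4 * C)" using assms by (intro real_sqrt_less_mono) simp
  finally show ?thesis unfolding sharp_const_def by simp
qed

lemma sharp_const_root:
  assumes "C > 0"
  shows "(sharp_const A C)\<^sup>2 + (A - 2) * sharp_const A C = C"
proof -
  have "(sqrt ((A - 2)\<^sup>2 + 4 * C))\<^sup>2 = (A - 2)\<^sup>2 + 4 * C"
    using assms by (intro real_sqrt_pow2) (simp add: add_nonneg_nonneg)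
  then show ?thesis
    unfolding sharp_const_def by (simp add: power2_eq_square field_simps)
qed

lemma gauss_weight_nonneg: "gauss_weight A s \<ge> 0"
  by (simp add: gauss_weight_def)

lemma gauss_weight_measurable [measurable]: "gauss_weight A \<in> borel_measurable borel"
  unfolding gauss_weight_def by measurable

text \<open>Absorbing the quotient into the power turns the flux into a plain product, ready for
  differentiation.\<close>

lemma gauss_weight_over_id:
  assumes "s > 0"
  shows "gauss_weight A s / s = exp (- (s\<^sup>2 / 2)) * s powr (A - 2)"
proof -
  have "s powr (A - 1) = s powr (A - 2) * s"
    using assms powr_add[of s "A - 2" 1] by simp
  then show ?thesis using assms by (simp add: gauss_weight_def)
qed

section \<open>Derivative of the flux and completion of the square\<close>

text \<open>The factor \<open>gauss_weight A s / s\<close> has logarithmic derivative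
  \<open>(A - 2) / s - s\<close>. Its Gaussian part yields the \<open>- 1\<close>, which is what
  later produces the mass term.\<close>

lemma has_real_derivative_flux:
  assumes "s > 0" and u: "(u has_real_derivative u') (at s)"
  shows "((\<lambda>s. (u s)\<^sup>2 * gauss_weight A s / s) has_real_derivative
           (2 * u s * u' / s + (u s)\<^sup>2 * ((A - 2) / s\<^sup>2 - 1)) * gauss_weight A s) (at s)"
proof -
  let ?h = "\<lambda>s. (u s)\<^sup>2 * (exp (- (s\<^sup>2 / 2)) * s powr (A - 2))"
  have p: "s powr (A - 1) = s powr (A - 2) * s" "s powr (A - 3) = s powr (A - 2) / s"
    using assms powr_add[of s "A - 2" 1] powr_diff[of s "A - 2" 1] by simp_all
  have "(?h has_real_derivative
           (2 * u s * u' / s + (u s)\<^sup>2 * ((A - 2) / s\<^sup>2 - 1)) * gauss_weight A s) (at s)"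
    unfolding gauss_weight_def
    using assms by (auto intro!: derivative_eq_intros simp: p power2_eq_square field_simps)
  then show ?thesis
  proof (rule has_field_derivative_transform_within_open[of _ _ _ "{0<..}"])
    show "?h t = (u t)\<^sup>2 * gauss_weight A t / t" if "t \<in> {0<..}" for t
      using that gauss_weight_over_id[of t A] by (metis greaterThan_iff times_divide_eq_right)
  qed (use assms in auto)
qed

text \<open>Read \<open>x\<close> as \<open>u s\<close> and \<open>y\<close> as \<open>u' s\<close>.
  Writing \<open>C\<close> as a polynomial in \<open>k\<close> makes this a purely algebraic
  identity: the cross terms cancel, and so do the terms in \<open>x\<^sup>2 * w\<close>.\<close>

lemma hardy_identity:
  fixes x y s w A k :: real
  assumes "s \<noteq> 0"
  shows "(y\<^sup>2 + (k\<^sup>2 + (A - 2) * k) * (x / s)\<^sup>2) * w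
    = k * (x\<^sup>2 * w) + (y - k * x / s)\<^sup>2 * w
      + k * ((2 * x * y / s + x\<^sup>2 * ((A - 2) / s\<^sup>2 - 1)) * w)"
  using assms by (simp add: power2_eq_square field_simps)

section \<open>The integrated inequality with its remainder\<close>

text \<open>The logarithm is unbounded near 0. This rules out a flux bounded away from 0 when the
  energy is finite.\<close>

lemma nn_integral_inverse_near_zero_infinite:
  fixes a :: real
  assumes "a > 0" and f [measurable]: "f \<in> borel_measurable borel" and "e > 0"
    and ge: "\<And>s. 0 < s \<Longrightarrow> s < a \<Longrightarrow> f s \<ge> e / s"
  shows "(\<integral>\<^sup>+ s. ennreal (f s) \<partial>lborel) = \<infinity>"
proof (rule ccontr)
  assume "\<not> ?thesis"
  then obtain I where I: "(\<integral>\<^sup>+ s. ennreal (f s) \<partial>lborel) = ennreal I" "I \<ge> 0"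
    by (cases "\<integral>\<^sup>+ s. ennreal (f s) \<partial>lborel") auto
  \<comment> \<open>\<open>N\<close> is chosen so that the integral of \<open>e / s\<close> from
    \<open>?d\<close> to \<open>?b\<close>, which is \<open>e * N\<close>, exceeds the supposed
    value \<open>I\<close> by 1.\<close>
  define N where "N = (I + 1) / e"
  have N: "N > 0" "e * N = I + 1" using I assms by (simp_all add: N_def)
  let ?b = "a / 2" and ?d = "a / 2 * exp (- N)"
  have d: "0 < ?d" "?d \<le> ?b" using assms N by auto
  have "(\<integral>\<^sup>+ s. ennreal (e / s) * indicator {?d..?b} s \<partial>lborel) = ennreal (e * ln ?b - e * ln ?d)"
    using assms d by (intro nn_integral_FTC_Icc) (auto intro!: derivative_eq_intros)
  also have "ln ?d = ln ?b - N"
    using assms by (subst ln_mult) auto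
  also have "e * ln ?b - e * (ln ?b - N) = I + 1"
    using N by (simp add: algebra_simps)
  finally have "ennreal (I + 1) = (\<integral>\<^sup>+ s. ennreal (e / s) * indicator {?d..?b} s \<partial>lborel)" by simp
  also have "\<dots> \<le> (\<integral>\<^sup>+ s. ennreal (f s) \<partial>lborel)"
  proof (intro nn_integral_mono)
    fix s
    show "ennreal (e / s) * indicator {?d..?b} s \<le> ennreal (f s)"
    proof (cases "s \<in> {?d..?b}")
      case True
      then have "?d \<le> s" "s \<le> ?b" by simp_all
      then have "0 < s" "s < a" using d(1) \<open>a > 0\<close> by linarith+
      then show ?thesis using ge[of s] by (auto simp: indicator_def intro!: ennreal_leI)
    qed simp
  qed
  finally show False using I by simp
qed

text \<open>The squared remainder is kept on the smaller side because the equality case needs it.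
  Functions that vanish for \<open>s \<le> 0\<close> allow integration over the whole line.\<close>

lemma hardy_remainder:
  fixes A C :: real and u v :: "real \<Rightarrow> real"
  defines "k \<equiv> sharp_const A C"
  assumes "C > 0"
    and u [measurable]: "u \<in> borel_measurable borel"
    and v [measurable]: "v \<in> borel_measurable borel"
    and deriv: "\<And>s. s > 0 \<Longrightarrow> (u has_real_derivative v s) (at s)"
    and zero: "\<And>s. s \<le> 0 \<Longrightarrow> u s = 0" "\<And>s. s \<le> 0 \<Longrightarrow> v s = 0"
  shows "(\<integral>\<^sup>+ s. ennreal (k * ((u s)\<^sup>2 * gauss_weight A s)
              + (v s - k * u s / s)\<^sup>2 * gauss_weight A s) \<partial>lborel)
       \<le> (\<integral>\<^sup>+ s. ennreal (((v s)\<^sup>2 + C * (u s / s)\<^sup>2) * gauss_weight A s) \<partial>lborel)"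
proof -
  define E where "E s = ((v s)\<^sup>2 + C * (u s / s)\<^sup>2) * gauss_weight A s" for s
  define R where "R s = k * ((u s)\<^sup>2 * gauss_weight A s)
      + (v s - k * u s / s)\<^sup>2 * gauss_weight A s" for s
  define G where "G s = (u s)\<^sup>2 * gauss_weight A s / s" for s
  define G' where "G' s = (2 * u s * v s / s + (u s)\<^sup>2 * ((A - 2) / s\<^sup>2 - 1)) * gauss_weight A s" for s
  have kpos: "k > 0" and root: "k\<^sup>2 + (A - 2) * k = C"
    using sharp_const_pos sharp_const_root \<open>C > 0\<close> by (auto simp: k_def)
  have [measurable]: "E \<in> borel_measurable borel" "R \<in> borel_measurable borel"
    unfolding E_def R_def by measurable
  have Epos: "E s \<ge> 0" and Rpos: "R s \<ge> 0" for s
    using \<open>C > 0\<close> kpos by (simp_all add: E_def R_def gauss_weight_nonneg)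
  have Gpos: "G s \<ge> 0" if "s > 0" for s
    using that by (simp add: G_def gauss_weight_nonneg)
  have R_eq: "R s = E s - k * G' s" if "s > 0" for s
    using hardy_identity[of s "v s" k A "u s" "gauss_weight A s"] that
    unfolding R_def E_def G'_def root by simp
  have "(\<integral>\<^sup>+ s. ennreal (R s) \<partial>lborel) \<le> (\<integral>\<^sup>+ s. ennreal (E s) \<partial>lborel)"
  proof (cases "(\<integral>\<^sup>+ s. ennreal (E s) \<partial>lborel) = \<infinity>")
    case False
    then have intE: "integrable lborel E"
      using Epos by (intro integrableI_nonneg) (auto simp: less_top)
    have EI: "(\<integral>\<^sup>+ s. ennreal (E s) \<partial>lborel) = ennreal (integral\<^sup>L lborel E)"
      using intE Epos by (intro nn_integral_eq_integral) auto
    have Rab: "(\<integral>\<^sup>+ s. ennreal (R s) * indicator {a..b} s \<partial>lborel)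
        \<le> ennreal (integral\<^sup>L lborel E + k * G a)" if ab: "0 < a" "a \<le> b" for a b
    proof -
      have sE: "set_integrable lborel {a..b} E"
        unfolding set_integrable_def using intE by (intro integrable_mult_indicator) auto
      \<comment> \<open>\<open>G'\<close> is a mere pointwise derivative, not known in advance to be
        Lebesgue integrable, so the subtraction is done with gauge integrals. The result returns to
        the Lebesgue integral because \<open>R\<close> is nonnegative.\<close>
      have "(E has_integral (LINT s:{a..b}|lborel. E s)) {a..b}"
        using has_integral_set_lebesgue[of "{a..b}" E] sE
          set_borel_integral_eq_integral[of "{a..b}" E] by (auto intro: integrable_integral)
      moreover have "(G' has_integral (G b - G a)) {a..b}"
        unfolding G_def G'_def using ab
        by (intro fundamental_theorem_of_calculus)
          (auto intro!: has_real_derivative_flux[THEN DERIV_subset] deriv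
            simp flip: has_real_derivative_iff_has_vector_derivative)
      ultimately have "((\<lambda>s. E s - k * G' s) has_integral
          ((LINT s:{a..b}|lborel. E s) - k * (G b - G a))) {a..b}"
        by (intro has_integral_diff has_integral_mult_right)
      then have "(R has_integral ((LINT s:{a..b}|lborel. E s) - k * (G b - G a))) {a..b}"
        using ab by (subst has_integral_cong[of _ _ "\<lambda>s. E s - k * G' s"]) (auto simp: R_eq)
      then have "(\<integral>\<^sup>+ s. ennreal (indicator {a..b} s * R s) \<partial>lborel)
          = ennreal ((LINT s:{a..b}|lborel. E s) - k * (G b - G a))"
        using nn_integral_has_integral_lebesgue[of "{a..b}" R] Rpos
        by simp
      also have "\<dots> \<le> ennreal (integral\<^sup>L lborel E + k * G a)"
      proof (rule ennreal_leI)
        have "(LINT s:{a..b}|lborel. E s) \<le> integral\<^sup>L lborel E"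
          unfolding set_lebesgue_integral_def
          using intE sE Epos by (intro integral_mono) (auto simp: set_integrable_def indicator_def)
        moreover have "k * G b \<ge> 0" using kpos Gpos[of b] ab by simp
        ultimately show "(LINT s:{a..b}|lborel. E s) - k * (G b - G a) \<le> integral\<^sup>L lborel E + k * G a"
          by (simp add: algebra_simps)
      qed
      finally show ?thesis by (simp add: nn_integral_set_ennreal mult.commute)
    qed
    \<comment> \<open>Finiteness of \<open>\<integral> G s / s ds\<close> forces the flux to vanish along a sequence tending to \<open>0\<close>.\<close>
    have small: "\<exists>s. 0 < s \<and> s < a \<and> G s < e" if "a > 0" "e > 0" for a e
    proof (rule ccontr)
      assume neg: "\<not> ?thesis"
      have "E s \<ge> C * e / s" if s: "0 < s" "s < a" for s
      proof -
        have "G s \<ge> e" using neg s by auto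
        then have "C * e / s \<le> C * G s / s" using s \<open>C > 0\<close> by (simp add: field_simps)
        also have "C * G s / s = C * (u s / s)\<^sup>2 * gauss_weight A s"
          by (simp add: G_def power2_eq_square)
        also have "\<dots> \<le> E s"
          unfolding E_def by (intro mult_right_mono) (simp_all add: gauss_weight_nonneg)
        finally show ?thesis .
      qed
      then have "(\<integral>\<^sup>+ s. ennreal (E s) \<partial>lborel) = \<infinity>"
        using that \<open>C > 0\<close> by (intro nn_integral_inverse_near_zero_infinite[of a _ "C * e"]) auto
      with False show False by simp
    qed
    have Rab': "(\<integral>\<^sup>+ s. ennreal (R s) * indicator {a..b} s \<partial>lborel) \<le> ennreal (integral\<^sup>L lborel E)"
      if ab: "0 < a" "a \<le> b" for a b
    proof (rule ennreal_le_epsilon)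
      fix e :: real assume "e > 0"
      \<comment> \<open>Enlarging the interval to the left can only increase the integral, and it
        moves the boundary term to a point where \<open>k * G s\<close> is below
        \<open>e\<close>.\<close>
      then obtain s where s: "0 < s" "s < a" "G s < e / k"
        using small[of a "e / k"] ab kpos by auto
      have "(\<integral>\<^sup>+ s. ennreal (R s) * indicator {a..b} s \<partial>lborel)
          \<le> (\<integral>\<^sup>+ t. ennreal (R t) * indicator {s..b} t \<partial>lborel)"
        using s by (intro nn_integral_mono) (auto simp: indicator_def)
      also have "\<dots> \<le> ennreal (integral\<^sup>L lborel E + k * G s)"
        using Rab[of s b] s ab by simp
      also have "\<dots> \<le> ennreal (integral\<^sup>L lborel E + e)"
        using s kpos by (intro ennreal_leI) (simp add: field_simps)
      finally show "(\<integral>\<^sup>+ s. ennreal (R s) * indicator {a..b} s \<partial>lborel)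
          \<le> ennreal (integral\<^sup>L lborel E) + ennreal e"
        using \<open>e > 0\<close> Epos by (simp add: ennreal_plus integral_nonneg)
    qed
    \<comment> \<open>These intervals exhaust the positive half-line. Only an upper bound is wanted,
      so Fatou's lemma suffices for the passage to the limit.\<close>
    let ?J = "\<lambda>n::nat. {1 / real (Suc n)..real (Suc n)}"
    have "(\<lambda>n. ennreal (R s) * indicator (?J n) s) \<longlonglongrightarrow> ennreal (R s)" for s
    proof (cases "s > 0")
      case True
      obtain n1 n2 where n: "1 / real (Suc n1) < s" "s < real n2"
        using nat_approx_posE[OF True] reals_Archimedean2 by metis
      have "\<forall>\<^sub>F n in sequentially. ennreal (R s) * indicator (?J n) s = ennreal (R s)"
      proof (rule eventually_sequentiallyI)
        fix n assume "max n1 n2 \<le> n"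
        moreover from this have "1 / real (Suc n) \<le> 1 / real (Suc n1)"
          by (intro divide_left_mono) auto
        ultimately have "s \<in> ?J n" using n by auto
        then show "ennreal (R s) * indicator (?J n) s = ennreal (R s)" by simp
      qed
      then show ?thesis by (rule tendsto_eventually)
    qed (simp add: R_def zero)
    then have "(\<integral>\<^sup>+ s. ennreal (R s) \<partial>lborel)
        = (\<integral>\<^sup>+ s. liminf (\<lambda>n. ennreal (R s) * indicator (?J n) s) \<partial>lborel)"
      by (intro nn_integral_cong) (metis lim_imp_Liminf sequentially_bot)
    also have "\<dots> \<le> liminf (\<lambda>n. \<integral>\<^sup>+ s. ennreal (R s) * indicator (?J n) s \<partial>lborel)"
      by (rule nn_integral_liminf) measurable
    also have "\<dots> \<le> ennreal (integral\<^sup>L lborel E)"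
    proof (rule Liminf_le)
      show "\<forall>\<^sub>F n in sequentially.
          (\<integral>\<^sup>+ s. ennreal (R s) * indicator (?J n) s \<partial>lborel) \<le> ennreal (integral\<^sup>L lborel E)"
      proof (intro always_eventually allI Rab')
        show "1 / real (Suc n) \<le> real (Suc n)" for n
          by (simp add: field_simps)
      qed simp
    qed simp
    finally show ?thesis using EI by simp
  qed simp
  then show ?thesis by (simp add: R_def E_def)
qed

section \<open>Measurability of the function and its derivative on the half-line\<close>

text \<open>The derivative is a pointwise limit of forward difference quotients. Forward steps stay
  inside the half-line, where each quotient is continuous.\<close>

lemma borel_measurable_deriv_Ioi:
  fixes u :: "real \<Rightarrow> real"
  assumes "\<And>s. s > 0 \<Longrightarrow> u differentiable (at s)"
  shows "(\<lambda>s. indicator {0<..} s * deriv u s) \<in> borel_measurable borel"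
proof (rule borel_measurable_LIMSEQ_real)
  let ?q = "\<lambda>n s. indicator {0<..} s *\<^sub>R ((u (s + 1 / real (Suc n)) - u s) * real (Suc n))"
  have cont: "isCont u s" if "s > 0" for s
    using assms[OF that] by (rule differentiable_imp_continuous_within)
  show "?q n \<in> borel_measurable borel" for n
  proof (rule borel_measurable_continuous_on_indicator)
    have "isCont (\<lambda>s. (u (s + 1 / real (Suc n)) - u s) * real (Suc n)) s" if "s > 0" for s
    proof -
      have "isCont (\<lambda>s. u (s + 1 / real (Suc n))) s"
        by (rule isCont_o2[of s "\<lambda>s. s + 1 / real (Suc n)" u])
          (use that in \<open>auto intro!: cont continuous_intros add_pos_nonneg\<close>)
      then show ?thesis using cont[OF that] by (intro continuous_intros)
    qed
    then show "continuous_on {0<..} (\<lambda>s. (u (s + 1 / real (Suc n)) - u s) * real (Suc n))"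
      by (auto intro!: continuous_at_imp_continuous_on)
  qed auto
  show "(\<lambda>n. ?q n s) \<longlonglongrightarrow> indicator {0<..} s * deriv u s" for s
  proof (cases "s > 0")
    case True
    then have "(u has_real_derivative deriv u s) (at s)"
      using assms DERIV_deriv_iff_real_differentiable by blast
    then have "((\<lambda>h. (u (s + h) - u s) / h) \<longlongrightarrow> deriv u s) (at 0)"
      by (simp add: DERIV_def)
    moreover have "filterlim (\<lambda>n. 1 / real (Suc n)) (at 0) sequentially"
      using LIMSEQ_inverse_real_of_nat by (auto simp: filterlim_at inverse_eq_divide)
    ultimately have "(\<lambda>n. (u (s + 1 / real (Suc n)) - u s) / (1 / real (Suc n))) \<longlonglongrightarrow> deriv u s"
      by (rule filterlim_compose)
    then show ?thesis using True by simp
  qed simp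
qed

lemma borel_measurable_differentiable_Ioi:
  fixes u :: "real \<Rightarrow> real"
  assumes "\<And>s. s > 0 \<Longrightarrow> u differentiable (at s)"
  shows "(\<lambda>s. indicator {0<..} s * u s) \<in> borel_measurable borel"
  using borel_measurable_continuous_on_indicator[of "{0<..}" u] assms
  by (auto intro!: continuous_at_imp_continuous_on differentiable_imp_continuous_within)

section \<open>Rigidity in the equality case\<close>

text \<open>The derivative of \<open>u s * s powr - k\<close> vanishes almost everywhere. Since that function is
  differentiable everywhere and not only almost everywhere, it is the Henstock-Kurzweil integral of
  its derivative, hence constant.\<close>

lemma AE_Euler_ode_imp_powr:
  fixes u :: "real \<Rightarrow> real"
  assumes deriv: "\<And>s. s > 0 \<Longrightarrow> (u has_real_derivative v s) (at s)"
    and ae: "AE s in lborel. s > 0 \<longrightarrow> v s = k * u s / s"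
  shows "\<exists>c. \<forall>s>0. u s = c * s powr k"
proof -
  define f where "f s = u s * s powr (- k)" for s
  define f' where "f' s = (v s - k * u s / s) * s powr (- k)" for s
  have f: "(f has_real_derivative f' s) (at s)" if "s > 0" for s
  proof -
    have "s powr (- k - 1) = s powr (- k) / s"
      using that powr_diff[of s "- k" 1] by simp
    then show ?thesis
      unfolding f_def f'_def using that
      by (auto intro!: derivative_eq_intros deriv simp: field_simps)
  qed
  \<comment> \<open>Negligible sets are the null sets of the completed measure, hence the passage
    from \<open>lborel\<close> to \<open>lebesgue\<close>.\<close>
  have "AE s in lebesgue. s > 0 \<longrightarrow> v s = k * u s / s"
    using ae by (rule AE_completion)
  then obtain N where N: "N \<in> null_sets lebesgue" "{s. \<not> (s > 0 \<longrightarrow> v s = k * u s / s)} \<subseteq> N"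
    by (auto simp: eventually_ae_filter)
  have const: "f b = f a" if ab: "0 < a" "a \<le> b" for a b
  proof -
    have "(f' has_integral (f b - f a)) {a..b}"
      using ab by (intro fundamental_theorem_of_calculus)
        (auto intro!: f[THEN DERIV_subset]
          simp flip: has_real_derivative_iff_has_vector_derivative)
    moreover have "(f' has_integral 0) {a..b}"
    proof (rule has_integral_spike[of N])
      show "negligible N" using N by (simp add: negligible_iff_null_sets)
      show "((\<lambda>_. 0) has_integral (0::real)) {a..b}" by simp
      show "f' s = 0" if "s \<in> {a..b} - N" for s
            proof -
        have "0 < s" "s \<notin> N" using that ab by auto
        then have "v s = k * u s / s" using N(2) by blast
        then show ?thesis by (simp add: f'_def)
      qed
    qed
    ultimately have "f b - f a = 0" by (rule has_integral_unique)
    then show ?thesis by simp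
  qed
  have "u s = f 1 * s powr k" if "s > 0" for s
  proof -
    have "f s = f 1"
    proof (cases "s \<le> 1")
      case True
      then show ?thesis by (rule const[OF that, symmetric])
    next
      case False
      then show ?thesis by (intro const) simp_all
    qed
    then show ?thesis using that by (auto simp: f_def powr_minus field_simps)
  qed
  then show ?thesis by blast
qed

section \<open>Gaussian moments and the extremal powers\<close>

text \<open>Expanding \<open>(s - 1)\<^sup>2 \<ge> 0\<close> bounds the Gaussian by a multiple of
  \<open>exp (- s)\<close>, so the integrand is dominated by that of the Gamma function.\<close>

lemma set_integrable_powr_gauss:
  fixes p :: real
  assumes "p > 0"
  shows "set_integrable lborel {0<..} (\<lambda>s. exp (- (s\<^sup>2 / 2)) * s powr (p - 1))"
proof (rule set_integrable_bound)
  have "(\<lambda>t. t powr (p - 1) / exp t) absolutely_integrable_on {0..}"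
    using Gamma_integral_real[OF assms]
    by (intro nonnegative_absolutely_integrable_1) (auto simp: integrable_on_def)
  then have "(\<lambda>t. t powr (p - 1) / exp t) absolutely_integrable_on {0<..}"
    by (rule set_integrable_subset) auto
  then have "set_integrable lborel {0<..} (\<lambda>t. t powr (p - 1) / exp t)"
    unfolding set_integrable_def by (subst (asm) integrable_completion) auto
  then show "set_integrable lborel {0<..} (\<lambda>t. exp (1/2) * (t powr (p - 1) / exp t))"
    by (rule set_integrable_mult_right)
  show "set_borel_measurable lborel {0<..} (\<lambda>s. exp (- (s\<^sup>2 / 2)) * s powr (p - 1))"
    unfolding set_borel_measurable_def by measurable
  have "exp (- (s\<^sup>2 / 2)) \<le> exp (1/2) / exp s" for s :: real
  proof -
    have "0 \<le> (s - 1)\<^sup>2" by simp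
    then have "- (s\<^sup>2 / 2) \<le> 1/2 - s" by (simp add: power2_diff)
    then show ?thesis by (simp flip: exp_diff)
  qed
  then have "exp (- (s\<^sup>2 / 2)) * s powr (p - 1) \<le> exp (1/2) / exp s * s powr (p - 1)" for s :: real
    by (rule mult_right_mono) simp
  then show "AE s in lborel. s \<in> {0<..} \<longrightarrow> norm (exp (- (s\<^sup>2 / 2)) * s powr (p - 1))
      \<le> norm (exp (1/2) * (s powr (p - 1) / exp s))"
    by (auto simp: abs_mult)
qed

text \<open>Integration by parts: the difference of the two sides is the integral of the derivative
  of \<open>exp (- (s\<^sup>2 / 2)) * s powr p\<close>, which tends to 0 at both ends since
  \<open>p > 0\<close>.\<close>

lemma LINT_powr_gauss_recurrence:
  fixes p :: real
  assumes "p > 0"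
  shows "(LINT s:{0<..}|lborel. exp (- (s\<^sup>2 / 2)) * s powr (p + 1))
       = p * (LINT s:{0<..}|lborel. exp (- (s\<^sup>2 / 2)) * s powr (p - 1))"
proof -
  let ?g = "\<lambda>q s :: real. exp (- (s\<^sup>2 / 2)) * s powr q"
  have int: "set_integrable lborel {0<..} (?g (p - 1))" "set_integrable lborel {0<..} (?g (p + 1))"
    using set_integrable_powr_gauss[of p] set_integrable_powr_gauss[of "p + 2"] assms
    by (simp_all add: add.commute)
  have "(LBINT s=0..\<infinity>. p * ?g (p - 1) s - ?g (p + 1) s) = 0 - 0"
  proof (rule interval_integral_FTC_integrable[where F = "?g p"])
    show "(?g p has_vector_derivative p * ?g (p - 1) s - ?g (p + 1) s) (at s)"
      if "0 < ereal s" for s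
    proof -
      have "s > 0" using that by simp
      then have "s powr (p - 1) = s powr p / s" "s powr (p + 1) = s powr p * s"
        by (simp_all add: powr_diff powr_add)
      with \<open>s > 0\<close> show ?thesis
        unfolding has_real_derivative_iff_has_vector_derivative[symmetric]
        by (auto intro!: derivative_eq_intros simp: field_simps)
    qed
    show "isCont (\<lambda>s. p * ?g (p - 1) s - ?g (p + 1) s) s" if "0 < ereal s" for s
      using that by (auto intro!: continuous_intros)
    show "set_integrable lborel (einterval 0 \<infinity>) (\<lambda>s. p * ?g (p - 1) s - ?g (p + 1) s)"
      using int by (auto simp: zero_ereal_def intro!: set_integral_diff set_integrable_mult_right)
    have "(?g p \<longlongrightarrow> 0) (at_right 0)"
      using assms by real_asymp
    then show "((?g p \<circ> real_of_ereal) \<longlongrightarrow> 0) (at_right 0)"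
      by (simp add: zero_ereal_def ereal_tendsto_simps)
    have "(?g p \<longlongrightarrow> 0) at_top"
      by real_asymp
    then show "((?g p \<circ> real_of_ereal) \<longlongrightarrow> 0) (at_left \<infinity>)"
      by (simp add: ereal_tendsto_simps)
  qed simp
  then have "(LINT s:{0<..}|lborel. p * ?g (p - 1) s - ?g (p + 1) s) = 0"
    by (simp add: interval_lebesgue_integral_def zero_ereal_def)
  then show ?thesis
    using int by (simp add: set_integral_diff)
qed

text \<open>For a power, energy and mass are multiples of the Gaussian moments with exponents
  \<open>p - 1\<close> and \<open>p + 1\<close>, where \<open>p = 2 * k + A - 2\<close>. The moment
  recurrence and \<open>k * p = k\<^sup>2 + C\<close> match them.\<close>

lemma weighted_energy_powr:
  assumes "C > 0" and u: "\<And>s. s > 0 \<Longrightarrow> u s = c * s powr sharp_const A C"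
  shows "weighted_energy A C u = ennreal (sharp_const A C) * weighted_mass A u"
    and "weighted_energy A C u < \<infinity>"
proof -
  define k where "k = sharp_const A C"
  define p where "p = 2 * k + A - 2"
  let ?g = "\<lambda>q s :: real. exp (- (s\<^sup>2 / 2)) * s powr q"
  let ?I = "\<lambda>q. LINT s:{0<..}|lborel. ?g q s"
  have k: "k > 0" "k\<^sup>2 + (A - 2) * k = C"
    using sharp_const_pos sharp_const_root \<open>C > 0\<close> by (auto simp: k_def)
  \<comment> \<open>The product equals \<open>C\<close>. Hence \<open>k + A - 2\<close> is positive,
    and adding \<open>k\<close> to it gives \<open>p\<close>.\<close>
  have "k * (k + A - 2) > 0"
    using k \<open>C > 0\<close> by (simp add: power2_eq_square algebra_simps)
  then have p: "p > 0"
    using k by (simp add: p_def zero_less_mult_iff)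
  have pk: "k * p = k\<^sup>2 + C"
    using k by (simp add: p_def power2_eq_square algebra_simps)
  have int: "set_integrable lborel {0<..} (?g (p - 1))" "set_integrable lborel {0<..} (?g (p + 1))"
    using set_integrable_powr_gauss[of p] set_integrable_powr_gauss[of "p + 2"] p
    by (simp_all add: add.commute)
  have I: "(\<integral>\<^sup>+ s \<in> {0<..}. ennreal (b * ?g q s) \<partial>lborel) = ennreal (b * ?I q)"
    if "set_integrable lborel {0<..} (?g q)" "b \<ge> 0" for b q
  proof -
    have "(\<integral>\<^sup>+ s \<in> {0<..}. ennreal (b * ?g q s) \<partial>lborel)
        = ennreal (LINT s:{0<..}|lborel. b * ?g q s)"
      using that unfolding set_lebesgue_integral_def
      by (subst nn_integral_eq_integral[symmetric])
        (auto simp: set_integrable_def mult_ac indicator_def intro!: nn_integral_cong)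
    then show ?thesis by simp
  qed
  have energy: "weighted_energy A C u = ennreal (c\<^sup>2 * (k\<^sup>2 + C) * ?I (p - 1))"
  proof -
    have "((deriv u s)\<^sup>2 + C * (u s / s)\<^sup>2) * gauss_weight A s = c\<^sup>2 * (k\<^sup>2 + C) * ?g (p - 1) s"
      if "s > 0" for s
    proof -
      have "((\<lambda>s. c * s powr k) has_real_derivative c * (k * s powr (k - 1))) (at s)"
        using that by (auto intro!: derivative_eq_intros)
      then have "(u has_real_derivative c * (k * s powr (k - 1))) (at s)"
        by (rule has_field_derivative_transform_within_open[of _ _ _ "{0<..}"])
          (use that u in \<open>auto simp: k_def\<close>)
      then have "deriv u s = c * k * s powr (k - 1)"
        by (simp add: DERIV_imp_deriv)
      moreover have "u s / s = c * s powr (k - 1)"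
        using that u by (simp add: k_def powr_diff)
      moreover have "s powr (p - 1) = (s powr (k - 1))\<^sup>2 * s powr (A - 1)"
        by (simp add: p_def power2_eq_square flip: powr_add)
      ultimately show ?thesis
        by (simp add: gauss_weight_def power_mult_distrib algebra_simps)
    qed
    then have "weighted_energy A C u
        = (\<integral>\<^sup>+ s \<in> {0<..}. ennreal (c\<^sup>2 * (k\<^sup>2 + C) * ?g (p - 1) s) \<partial>lborel)"
      unfolding weighted_energy_def by (intro nn_integral_cong) (auto simp: indicator_def)
    then show ?thesis
      using I[OF int(1), of "c\<^sup>2 * (k\<^sup>2 + C)"] \<open>C > 0\<close> by simp
  qed
  have mass: "weighted_mass A u = ennreal (c\<^sup>2 * ?I (p + 1))"
  proof -
    have "(u s)\<^sup>2 * gauss_weight A s = c\<^sup>2 * ?g (p + 1) s" if "s > 0" for s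
    proof -
      have "s powr (p + 1) = (s powr k)\<^sup>2 * s powr (A - 1)"
        by (simp add: p_def add_diff_eq power2_eq_square flip: powr_add)
      then show ?thesis
        using that u by (simp add: gauss_weight_def k_def power_mult_distrib)
    qed
    then have "weighted_mass A u = (\<integral>\<^sup>+ s \<in> {0<..}. ennreal (c\<^sup>2 * ?g (p + 1) s) \<partial>lborel)"
      unfolding weighted_mass_def by (intro nn_integral_cong) (auto simp: indicator_def)
    then show ?thesis using I[OF int(2), of "c\<^sup>2"] by simp
  qed
  have eq: "c\<^sup>2 * (k\<^sup>2 + C) * ?I (p - 1) = k * (c\<^sup>2 * ?I (p + 1))"
    unfolding LINT_powr_gauss_recurrence[OF p] pk[symmetric] by simp
  show "weighted_energy A C u = ennreal (sharp_const A C) * weighted_mass A u"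
    using k unfolding energy mass k_def[symmetric] eq by (intro ennreal_mult') simp
  show "weighted_energy A C u < \<infinity>"
    unfolding energy by simp
qed

section \<open>The inequality and its extremal functions\<close>

text \<open>Finiteness accompanies equality because both sides can be \<infinity> for a function
  that is not such a power, for instance \<open>exp (s\<^sup>2)\<close>.\<close>

theorem theorem1p4:
  fixes A C :: real and u :: "real \<Rightarrow> real"
  assumes "A \<ge> 2" and "C > 0"
    and "\<And>s. s > 0 \<Longrightarrow> u differentiable (at s)"
  shows "weighted_energy A C u \<ge> ennreal (sharp_const A C) * weighted_mass A u
    \<and> ((weighted_energy A C u = ennreal (sharp_const A C) * weighted_mass A u
          \<and> weighted_energy A C u < \<infinity>)
        \<longleftrightarrow> (\<exists>c. \<forall>s>0. u s = c * s powr sharp_const A C))"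
proof -
  define k where "k = sharp_const A C"
  \<comment> \<open>Nothing is assumed about \<open>u\<close> or \<open>deriv u\<close> outside the
    half-line, so both are cut off to become Borel functions on the whole line.\<close>
  define U where "U s = indicator {0<..} s * u s" for s
  define V where "V s = indicator {0<..} s * deriv u s" for s
  define M where "M s = (U s)\<^sup>2 * gauss_weight A s" for s
  define D where "D s = (V s - k * U s / s)\<^sup>2 * gauss_weight A s" for s
  have k: "k > 0" using sharp_const_pos \<open>C > 0\<close> by (simp add: k_def)
  have [measurable]: "U \<in> borel_measurable borel" "V \<in> borel_measurable borel"
    unfolding U_def V_def
    by (intro borel_measurable_differentiable_Ioi borel_measurable_deriv_Ioi assms; assumption)+
  have [measurable]: "M \<in> borel_measurable borel" "D \<in> borel_measurable borel"
    unfolding M_def D_def by measurable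
  have MD: "M s \<ge> 0" "D s \<ge> 0" for s
    by (simp_all add: M_def D_def gauss_weight_nonneg)
  have du: "(u has_real_derivative deriv u s) (at s)" if "s > 0" for s
    using assms(3)[OF that] DERIV_deriv_iff_real_differentiable by blast
  have dU: "(U has_real_derivative V s) (at s)" if "s > 0" for s
  proof (rule has_field_derivative_transform_within_open[of u _ _ "{0<..}"])
    show "(u has_real_derivative V s) (at s)"
      using du that by (simp add: V_def)
  qed (use that in \<open>auto simp: U_def\<close>)
  have energy: "weighted_energy A C u
      = (\<integral>\<^sup>+ s. ennreal (((V s)\<^sup>2 + C * (U s / s)\<^sup>2) * gauss_weight A s) \<partial>lborel)"
    unfolding weighted_energy_def
    by (intro nn_integral_cong) (auto simp: U_def V_def indicator_def)
  have mass: "weighted_mass A u = (\<integral>\<^sup>+ s. ennreal (M s) \<partial>lborel)"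
    unfolding weighted_mass_def
    by (intro nn_integral_cong) (auto simp: M_def U_def indicator_def)
  have "ennreal k * weighted_mass A u + (\<integral>\<^sup>+ s. ennreal (D s) \<partial>lborel)
      = (\<integral>\<^sup>+ s. ennreal (k * M s + D s) \<partial>lborel)"
    using k MD by (simp add: mass ennreal_plus ennreal_mult' nn_integral_add nn_integral_cmult)
  also have "\<dots> \<le> weighted_energy A C u"
    unfolding energy M_def D_def k_def
  proof (rule hardy_remainder)
    show "U s = 0" "V s = 0" if "s \<le> 0" for s
      using that by (simp_all add: U_def V_def)
  qed (use \<open>C > 0\<close> dU in auto)
  finally have main: "ennreal k * weighted_mass A u + (\<integral>\<^sup>+ s. ennreal (D s) \<partial>lborel)
      \<le> weighted_energy A C u" .
  have "\<exists>c. \<forall>s>0. u s = c * s powr k"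
    if eq: "weighted_energy A C u = ennreal k * weighted_mass A u" and fin: "weighted_energy A C u < \<infinity>"
  proof (rule AE_Euler_ode_imp_powr[OF du])
    have "ennreal k * weighted_mass A u + (\<integral>\<^sup>+ s. ennreal (D s) \<partial>lborel)
        \<le> ennreal k * weighted_mass A u + 0"
      using main eq by simp
    \<comment> \<open>Cancelling the mass term in \<open>ennreal\<close> requires it to be finite,
      which \<open>fin\<close> and \<open>eq\<close> provide.\<close>
    then have "(\<integral>\<^sup>+ s. ennreal (D s) \<partial>lborel) = 0"
      using fin eq by (auto simp: ennreal_add_left_cancel_le)
    then have "AE s in lborel. ennreal (D s) = 0"
      by (subst (asm) nn_integral_0_iff_AE) auto
    \<comment> \<open>The weight is positive on the half-line, so a vanishing \<open>D s\<close>
      forces its squared factor to vanish.\<close>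
    then show "AE s in lborel. s > 0 \<longrightarrow> deriv u s = k * u s / s"
      by eventually_elim
        (use MD in \<open>auto simp: D_def U_def V_def gauss_weight_def ennreal_eq_0_iff mult_le_0_iff\<close>)
  qed
  moreover have "weighted_energy A C u \<ge> ennreal k * weighted_mass A u"
    using main by (rule order_trans[rotated]) simp
  ultimately show ?thesis
    using weighted_energy_powr[OF \<open>C > 0\<close>, of u _ A] unfolding k_def by blast
qed

end
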